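(* Let $0<\mu<L<\infty$, $q=\mu/L$, let $f:\mathbb{R}^n\to\mathbb{R}$ belong to $\mathcal{F}_{\mu,L}(\mathbb{R}^n)$, and let $f_\star=\min_{x\in\mathbb{R}^n}f(x)$. Let $k\ge0$, and let $(x_k,d_k)$ and $(x_{k+1},d_{k+1})$ in $\mathbb{R}^n\times\mathbb{R}^n$ be generated by respectively $k$ and $k+1$ iterations of the Fletcher-Reeves (FR) nonlinear conjugate gradient method with exact line search. Then $$f(x_{k+1})-f_\star\le\left(\frac{1-q\,\frac{1-\epsilon_k}{1+\epsilon_k}}{1+q\,\frac{1-\epsilon_k}{1+\epsilon_k}}\right)^2\left(f(x_k)-f_\star\right),\qquad\text{where}\quad \epsilon_k=\sqrt{\frac{(1-q)^2k^2}{4q+(1-q)^2k^2}}.$$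
   Context: $\mathcal{F}_{\mu,L}(\mathbb{R}^n)$ is the class of differentiable (closed, proper) convex functions $f:\mathbb{R}^n\to\mathbb{R}$ that are $L$-smooth, i.e. $\|\nabla f(x)-\nabla f(y)\|\le L\|x-y\|$ for all $x,y$, and $\mu$-strongly convex, i.e. $f(x)\ge f(y)+\langle\nabla f(y);x-y\rangle+\frac{\mu}{2}\|x-y\|^2$ for all $x,y$. Here $\langle\cdot;\cdot\rangle$ and $\|\cdot\|$ are the Euclidean inner product and norm. The FR method with exact line search starts from $x_0\in\mathbb{R}^n$ with $d_0=\nabla f(x_0)$ and iterates, for $k=0,1,2,\dots$: $\gamma_k\in\operatorname{argmin}_{\gamma\in\mathbb{R}}f(x_k-\gamma d_k)$; $x_{k+1}=x_k-\gamma_kd_k$; $\beta_k=\dfrac{\|\nabla f(x_{k+1})\|^2}{\|\nabla f(x_k)\|^2}$; $d_{k+1}=\nabla f(x_{k+1})+\beta_kd_k$. It is understood that $\nabla f(x_j)\ne0$ whenever $\beta_j$ is formed, so that all quantities are well defined. *)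

theory Defs
  imports "HOL-Analysis.Analysis"
begin

definition gradient :: "('a::real_inner \<Rightarrow> real) \<Rightarrow> 'a \<Rightarrow> 'a" where
  "gradient f x = (THE D. GDERIV f x :> D)"

lemma gradient_eqI:
  assumes "GDERIV f x :> D"
  shows "gradient f x = D"
  unfolding gradient_def
proof (rule the_equality)
  fix E assume "GDERIV f x :> E"
  then have "(\<lambda>h. h \<bullet> E) = (\<lambda>h. h \<bullet> D)"
    using assms unfolding gderiv_def by (rule has_derivative_unique)
  then have "(E - D) \<bullet> E = (E - D) \<bullet> D" by metis
  then have "(E - D) \<bullet> (E - D) = 0" by (simp add: inner_diff_right)
  then show "E = D" by simp
qed (fact assms)

text \<open>The functions are real-valued on the whole space, so properness holds by typing and
  closedness follows from differentiability.\<close>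

definition smooth_strongly_convex :: "real \<Rightarrow> real \<Rightarrow> ('a::real_inner \<Rightarrow> real) set" where
  "smooth_strongly_convex \<mu> L = {f.
     (\<forall>x. f differentiable (at x)) \<and>
     convex_on UNIV f \<and>
     (\<forall>x y. norm (gradient f x - gradient f y) \<le> L * norm (x - y)) \<and>
     (\<forall>x y. f x \<ge> f y + gradient f y \<bullet> (x - y) + \<mu> / 2 * (norm (x - y))\<^sup>2)}"

text \<open>The attained minimum: \<open>LEAST\<close> is meaningful only if some point realises it,
  so nothing is known about this value until existence of a minimiser has been proved.\<close>

definition min_value :: "('a \<Rightarrow> real) \<Rightarrow> real" where
  "min_value f = (LEAST v. v \<in> range f)"

text \<open>The sequences record \<open>N\<close> iterations; entries of \<open>x\<close> and \<open>d\<close> beyond index \<open>N\<close> (of \<open>\<gamma>\<close> and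
  \<open>\<beta>\<close> from index \<open>N\<close> on) are unconstrained. The line search ranges over all reals, negative
  steps included. Directions are ascent directions, hence the minus sign in the update.\<close>

definition FR_iterations ::
  "('a::real_inner \<Rightarrow> real) \<Rightarrow> nat \<Rightarrow> (nat \<Rightarrow> 'a) \<Rightarrow> (nat \<Rightarrow> 'a) \<Rightarrow> (nat \<Rightarrow> real) \<Rightarrow> (nat \<Rightarrow> real) \<Rightarrow> bool"
where
  "FR_iterations f N x d \<gamma> \<beta> \<longleftrightarrow>
     d 0 = gradient f (x 0) \<and>
     (\<forall>j<N.
        is_arg_min (\<lambda>t. f (x j - t *\<^sub>R d j)) (\<lambda>_. True) (\<gamma> j) \<and>
        x (Suc j) = x j - \<gamma> j *\<^sub>R d j \<and>
        gradient f (x j) \<noteq> 0 \<and>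
        \<beta> j = (norm (gradient f (x (Suc j))))\<^sup>2 / (norm (gradient f (x j)))\<^sup>2 \<and>
        d (Suc j) = gradient f (x (Suc j)) + \<beta> j *\<^sub>R d j)"

end

theory Submission
  imports Defs
begin

text \<open>
  Write \<open>g\<close> for the gradient of \<open>f\<close> and \<open>g\<^sub>k = g (x\<^sub>k)\<close>. Exact line searches make \<open>g\<^sub>k\<^sub>+\<^sub>1\<close> orthogonal
  to \<open>d\<^sub>k\<close>, whence \<open>g\<^sub>k \<bullet> d\<^sub>k = \<parallel>g\<^sub>k\<parallel>\<^sup>2\<close> for every \<open>k\<close>. The proof bounds the angle between \<open>d\<^sub>k\<close> and \<open>g\<^sub>k\<close>,
  and then the decrease that a line search achieves along a direction at that angle.

  \<^bold>\<open>The angle.\<close> Put \<open>\<kappa> = (L - \<mu>) / (2 sqrt (L \<mu>)) = (1 - q) / (2 sqrt q)\<close>. Cocoercivity of the gradient at the two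
  ends of a line search limits \<open>\<parallel>g\<^sub>k\<^sub>+\<^sub>1\<parallel>\<close> in terms of \<open>\<parallel>g\<^sub>k\<parallel>\<close> and the angle
  (\<open>line_search_gradient_growth\<close>); since \<open>d\<^sub>k\<^sub>+\<^sub>1 - g\<^sub>k\<^sub>+\<^sub>1 = \<beta>\<^sub>k d\<^sub>k\<close>, this says exactly that the
  ratio \<open>\<parallel>d\<^sub>k - g\<^sub>k\<parallel> / \<parallel>g\<^sub>k\<parallel>\<close>, the tangent of the angle, grows by at most \<open>\<kappa>\<close> per iteration
  (\<open>FR_direction_growth\<close>). So the tangent is at most \<open>k \<kappa>\<close>, and the sine at most
  \<open>k \<kappa> / sqrt (1 + k\<^sup>2 \<kappa>\<^sup>2) = \<epsilon>\<^sub>k\<close>.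

  \<^bold>\<open>The decrease.\<close> By the extremal case of the Kantorovich inequality, two vectors at an acute angle with sine
  \<open>\<epsilon>\<close> are related, up to a positive factor, by a symmetric positive definite \<open>P\<close> with spectrum in
  \<open>[1 - \<epsilon>, 1 + \<epsilon>]\<close>. In the metric given by the inverse of \<open>P\<close> the direction \<open>d\<^sub>k\<close> is a multiple
  of the gradient, so the step is an exact steepest descent step, for a function whose strong
  convexity and smoothness constants have become \<open>(1 - \<epsilon>) \<mu>\<close> and \<open>(1 + \<epsilon>) L\<close>. Writing
  \<open>P = A\<^sup>2\<close>, this is the substitution \<open>x = A y\<close> (\<open>inexact_direction_rate\<close>). For exact steepest descent the sharp rate
  \<open>((L - \<mu>) / (L + \<mu>))\<^sup>2\<close> follows by writing a combination of three interpolation inequalities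
  as a sum of squares (\<open>orthogonal_gradient_rate\<close>); replacing \<open>\<mu> / L\<close> in it by
  \<open>q (1 - \<epsilon>) / (1 + \<epsilon>)\<close> gives the claimed factor.
\<close>

section \<open>Quadratic bounds and the interpolation inequality\<close>

text \<open>The function class in the form that survives a linear change of variables: only values and
  inner products with \<open>g\<close> enter, and \<open>g\<close> is a parameter so that the transformed gradient can be
  named without differentiating again.\<close>

definition quadratic_bounds ::
  "real \<Rightarrow> real \<Rightarrow> ('a::real_inner \<Rightarrow> real) \<Rightarrow> ('a \<Rightarrow> 'a) \<Rightarrow> bool" where
  "quadratic_bounds \<mu> L f g \<longleftrightarrow>
     (\<forall>x y. f x + g x \<bullet> (y - x) + \<mu> / 2 * (norm (y - x))\<^sup>2 \<le> f y) \<and>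
     (\<forall>x y. f y \<le> f x + g x \<bullet> (y - x) + L / 2 * (norm (y - x))\<^sup>2)"

lemma quadratic_bounds_lower:
  "quadratic_bounds \<mu> L f g \<Longrightarrow> f x + g x \<bullet> (y - x) + \<mu> / 2 * (norm (y - x))\<^sup>2 \<le> f y"
  by (simp add: quadratic_bounds_def)

lemma quadratic_bounds_upper:
  "quadratic_bounds \<mu> L f g \<Longrightarrow> f y \<le> f x + g x \<bullet> (y - x) + L / 2 * (norm (y - x))\<^sup>2"
  by (simp add: quadratic_bounds_def)

lemma differentiable_imp_GDERIV_gradient:
  fixes f :: "'a::euclidean_space \<Rightarrow> real"
  assumes "f differentiable (at x)"
  shows "GDERIV f x :> gradient f x"
proof -
  obtain D where D: "(f has_derivative D) (at x)"
    using assms by (auto simp: differentiable_def)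
  then have "linear D" by (rule has_derivative_linear)
  then have "D h = h \<bullet> adjoint D 1" for h
    using adjoint_works[of D h 1] by simp
  then have "D = (\<lambda>h. h \<bullet> adjoint D 1)" by blast
  with D have "GDERIV f x :> adjoint D 1" unfolding gderiv_def by metis
  then show ?thesis using gradient_eqI by metis
qed

text \<open>The upper bound is the descent lemma. Along the segment from \<open>x\<close> to \<open>y\<close>, the Lipschitz condition makes the
  difference between \<open>f\<close> and its quadratic upper model nonincreasing; integrating it this way, rather
  than combining it with convexity, gives the constant \<open>L / 2\<close> instead of \<open>L\<close>.\<close>

lemma smooth_strongly_convex_quadratic_bounds:
  fixes f :: "'a::euclidean_space \<Rightarrow> real"
  assumes "f \<in> smooth_strongly_convex \<mu> L"
  shows "quadratic_bounds \<mu> L f (gradient f)"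
  unfolding quadratic_bounds_def
proof (intro conjI allI)
  fix x y :: 'a
  show "f x + gradient f x \<bullet> (y - x) + \<mu> / 2 * (norm (y - x))\<^sup>2 \<le> f y"
    using assms by (simp add: smooth_strongly_convex_def)
  have lip: "norm (gradient f u - gradient f v) \<le> L * norm (u - v)" for u v
    using assms by (simp add: smooth_strongly_convex_def)
  define v where "v = y - x"
  define \<phi> where "\<phi> = (\<lambda>t. f (x + t *\<^sub>R v) - t * (gradient f x \<bullet> v) - L / 2 * t\<^sup>2 * (norm v)\<^sup>2)"
  have deriv: "(\<phi> has_real_derivative
      (gradient f (x + t *\<^sub>R v) \<bullet> v - gradient f x \<bullet> v - L * t * (norm v)\<^sup>2)) (at t)" for t
  proof -
    have "(f has_derivative (\<lambda>h. h \<bullet> gradient f (x + t *\<^sub>R v))) (at (x + t *\<^sub>R v))"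
      using assms differentiable_imp_GDERIV_gradient[of f "x + t *\<^sub>R v"]
      by (simp add: smooth_strongly_convex_def gderiv_def)
    moreover have "((\<lambda>t. x + t *\<^sub>R v) has_derivative (\<lambda>h. h *\<^sub>R v)) (at t)"
      by (auto intro!: derivative_eq_intros)
    ultimately have "((\<lambda>t. f (x + t *\<^sub>R v)) has_derivative
        (\<lambda>h. (h *\<^sub>R v) \<bullet> gradient f (x + t *\<^sub>R v))) (at t)"
      using has_derivative_compose by blast
    then have "((\<lambda>t. f (x + t *\<^sub>R v)) has_real_derivative gradient f (x + t *\<^sub>R v) \<bullet> v) (at t)"
      by (simp add: has_field_derivative_def inner_commute mult.commute[of _ "_ \<bullet> _"])
    then show ?thesis
      unfolding \<phi>_def by (auto intro!: derivative_eq_intros)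
  qed
  have "\<phi> 1 \<le> \<phi> 0"
  proof (rule DERIV_nonpos_imp_nonincreasing[of 0 1 \<phi>])
    fix t :: real assume t: "0 \<le> t" "t \<le> 1"
    have "gradient f (x + t *\<^sub>R v) \<bullet> v - gradient f x \<bullet> v
        \<le> norm (gradient f (x + t *\<^sub>R v) - gradient f x) * norm v"
      by (metis inner_diff_left norm_cauchy_schwarz)
    also have "\<dots> \<le> (L * norm (t *\<^sub>R v)) * norm v"
      using lip[of "x + t *\<^sub>R v" x] by (intro mult_right_mono) auto
    also have "\<dots> = L * t * (norm v)\<^sup>2"
      using t by (simp add: power2_eq_square)
    finally show "\<exists>z. (\<phi> has_real_derivative z) (at t) \<and> z \<le> 0"
      using deriv[of t] by auto
  qed simp
  then show "f y \<le> f x + gradient f x \<bullet> (y - x) + L / 2 * (norm (y - x))\<^sup>2"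
    by (simp add: \<phi>_def v_def)
qed

text \<open>Subtracting \<open>\<mu> / 2\<close> times the squared norm from \<open>f\<close> leaves a convex function that is
  \<open>(L - \<mu>)\<close>-smooth. The inequality is the classical refinement of the gradient inequality for that function,
  obtained by comparing the lower bound at \<open>x\<close> with the upper bound at \<open>y\<close> in one third point.\<close>

lemma interpolation_inequality:
  assumes qb: "quadratic_bounds \<mu> L f g" and "\<mu> < L"
  shows "(norm (g x - g y))\<^sup>2 + \<mu> * L * (norm (x - y))\<^sup>2 - 2 * \<mu> * ((g x - g y) \<bullet> (x - y))
    \<le> 2 * (L - \<mu>) * (f y - f x - g x \<bullet> (y - x))"
proof -
  define c where "c = L - \<mu>"
  \<comment> \<open>The third point \<open>y - s\<close> is one gradient step with step size \<open>1 / (L - \<mu>)\<close> for the reduced function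
    minus its linearisation at \<open>x\<close>; it makes the comparison as strong as possible.\<close>
  define s where "s = (1 / c) *\<^sub>R ((g y - g x) - \<mu> *\<^sub>R (y - x))"
  have c: "c > 0" and L: "L = c + \<mu>" using assms by (auto simp: c_def)
  then have gy: "g y = g x + c *\<^sub>R s + \<mu> *\<^sub>R (y - x)"
    by (simp add: s_def)
  have "f x + g x \<bullet> ((y - s) - x) + \<mu> / 2 * (norm ((y - s) - x))\<^sup>2
      \<le> f y + g y \<bullet> ((y - s) - y) + L / 2 * (norm ((y - s) - y))\<^sup>2"
    using quadratic_bounds_lower[OF qb] quadratic_bounds_upper[OF qb] by (rule order_trans)
  then have "f x + g x \<bullet> (y - x) + \<mu> / 2 * (norm (y - x))\<^sup>2 + c / 2 * (norm s)\<^sup>2 \<le> f y"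
    by (simp add: gy L power2_norm_eq_inner inner_simps inner_commute field_simps)
  then have "2 * c * (f x + g x \<bullet> (y - x) + \<mu> / 2 * (norm (y - x))\<^sup>2 + c / 2 * (norm s)\<^sup>2)
      \<le> 2 * c * f y"
    using c by simp
  moreover have "(norm (g x - g y))\<^sup>2 + \<mu> * L * (norm (x - y))\<^sup>2
      - 2 * \<mu> * ((g x - g y) \<bullet> (x - y)) = c\<^sup>2 * (norm s)\<^sup>2 + \<mu> * c * (norm (y - x))\<^sup>2"
    unfolding gy L power2_norm_eq_inner
    by (simp add: inner_simps inner_commute power2_eq_square algebra_simps)
  ultimately show ?thesis
    unfolding L by (simp add: algebra_simps power2_eq_square)
qed

section \<open>One step along an exact gradient direction\<close>

text \<open>The rate of exact steepest descent. The two orthogonality relations encode the line search: the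
  new gradient is orthogonal to the line, whose direction is the old gradient.\<close>

lemma orthogonal_gradient_rate:
  assumes qb: "quadratic_bounds \<mu> L f g" and \<mu>: "0 < \<mu>" "\<mu> < L"
    and "g xs = 0" "g x1 \<bullet> (x0 - x1) = 0" "g x1 \<bullet> g x0 = 0"
  shows "(L + \<mu>)\<^sup>2 * (f x1 - f xs) \<le> (L - \<mu>)\<^sup>2 * (f x0 - f xs)"
proof -
  define u v where "u = x0 - xs" and "v = x1 - xs"
  define G0 G1 where "G0 = g x0" and "G1 = g x1"
  define F0 F1 where "F0 = f x0 - f xs" and "F1 = f x1 - f xs"
  note defs = u_def v_def G0_def G1_def F0_def F1_def
  have orth: "G1 \<bullet> u = G1 \<bullet> v" "G1 \<bullet> G0 = 0"
    using assms by (auto simp: defs inner_diff_right)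
  \<comment> \<open>The multipliers below come from the semidefinite program dual to the worst case: the
    interpolation inequalities between the pairs \<open>(x0, x1)\<close>, \<open>(xs, x0)\<close> and \<open>(xs, x1)\<close> are weighted
    in the proportions \<open>L\<^sup>2 - \<mu>\<^sup>2\<close>, \<open>2 \<mu> (L - \<mu>)\<close> and \<open>2 \<mu> (L + \<mu>)\<close>. Modulo the orthogonality
    relations, the quadratic part of the sum has rank two, and \<open>V\<close>, \<open>W\<close> diagonalise it.
    All denominators are cleared.\<close>
  define V where "V = (L * (L + 3 * \<mu>)) *\<^sub>R u - (L * (L + \<mu>)) *\<^sub>R v - (3 * L + \<mu>) *\<^sub>R G0 - (L + \<mu>) *\<^sub>R G1"
  define W where "W = (2 * \<mu> * L * (L + \<mu>)) *\<^sub>R v - (L - \<mu>)\<^sup>2 *\<^sub>R G0 - (L + \<mu>)\<^sup>2 *\<^sub>R G1"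
  define T01 where "T01 = 2 * (L - \<mu>) * (F0 - F1 - G1 \<bullet> (u - v))
     - ((norm (G1 - G0))\<^sup>2 + \<mu> * L * (norm (v - u))\<^sup>2 - 2 * \<mu> * ((G1 - G0) \<bullet> (v - u)))"
  define T0 where "T0 = 2 * (L - \<mu>) * (- F0 + G0 \<bullet> u)
     - ((norm G0)\<^sup>2 + \<mu> * L * (norm u)\<^sup>2 - 2 * \<mu> * (G0 \<bullet> u))"
  define T1 where "T1 = 2 * (L - \<mu>) * (- F1 + G1 \<bullet> v)
     - ((norm G1)\<^sup>2 + \<mu> * L * (norm v)\<^sup>2 - 2 * \<mu> * (G1 \<bullet> v))"
  have T: "T01 \<ge> 0" "T0 \<ge> 0" "T1 \<ge> 0"
    using interpolation_inequality[OF qb \<mu>(2), of x1 x0]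
      interpolation_inequality[OF qb \<mu>(2), of x0 xs]
      interpolation_inequality[OF qb \<mu>(2), of x1 xs] assms(4)
    by (simp_all add: T01_def T0_def T1_def defs inner_diff_right algebra_simps)
  have sos: "L * (L + 3 * \<mu>) * (2 * (L - \<mu>)) * ((L - \<mu>)\<^sup>2 * F0 - (L + \<mu>)\<^sup>2 * F1)
    = L * (L + 3 * \<mu>) * ((L\<^sup>2 - \<mu>\<^sup>2) * T01 + 2 * \<mu> * (L - \<mu>) * T0 + 2 * \<mu> * (L + \<mu>) * T1)
      + \<mu> * (L - \<mu>) * (norm V)\<^sup>2 + (norm W)\<^sup>2"
    using orth unfolding T01_def T0_def T1_def V_def W_def
    by (simp add: power2_norm_eq_inner inner_simps inner_commute)
      (simp add: algebra_simps eval_nat_numeral)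
  have "L\<^sup>2 - \<mu>\<^sup>2 \<ge> 0" using \<mu> by (simp add: power_mono)
  then have "0 \<le> L * (L + 3 * \<mu>) * (2 * (L - \<mu>)) * ((L - \<mu>)\<^sup>2 * F0 - (L + \<mu>)\<^sup>2 * F1)"
    unfolding sos using \<mu> T by (intro add_nonneg_nonneg mult_nonneg_nonneg) auto
  moreover have "0 < L * (L + 3 * \<mu>) * (2 * (L - \<mu>))" using \<mu> by simp
  ultimately have "0 \<le> (L - \<mu>)\<^sup>2 * F0 - (L + \<mu>)\<^sup>2 * F1"
    by (metis zero_le_mult_iff linorder_not_le)
  then show ?thesis by (simp add: F0_def F1_def)
qed


text \<open>The upper quadratic bound along the line has slope \<open>g x \<bullet> d\<close> at \<open>x\<close>,
  and its minimum lies below \<open>f x\<close> unless that slope vanishes. With \<open>d = g x\<close> it also shows that the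
  gradient vanishes at a global minimiser.\<close>

lemma line_minimum_orthogonal:
  assumes qb: "quadratic_bounds \<mu> L f g" and "0 < L"
    and min: "\<And>s. f x \<le> f (x + s *\<^sub>R d)"
  shows "g x \<bullet> d = 0"
proof (cases "d = 0")
  case False
  define a where "a = g x \<bullet> d"
  define s where "s = - a / (L * (norm d)\<^sup>2)"
  have "f x \<le> f x + g x \<bullet> (s *\<^sub>R d) + L / 2 * (norm (s *\<^sub>R d))\<^sup>2"
    using min[of s] quadratic_bounds_upper[OF qb, of "x + s *\<^sub>R d" x] by simp
  then have "0 \<le> s * a + L / 2 * s\<^sup>2 * (norm d)\<^sup>2"
    by (simp add: a_def power_mult_distrib)
  also have "\<dots> = - (a\<^sup>2 / (2 * L * (norm d)\<^sup>2))"
    using False \<open>0 < L\<close> by (simp add: s_def field_simps power2_eq_square)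
  finally have "a\<^sup>2 / (2 * L * (norm d)\<^sup>2) \<le> 0" by simp
  moreover have "0 < 2 * L * (norm d)\<^sup>2" using False \<open>0 < L\<close> by simp
  ultimately have "a\<^sup>2 \<le> 0" by (metis pos_divide_le_eq mult_zero_left)
  then show ?thesis by (simp add: a_def)
qed simp

section \<open>Inexact directions by a change of variables\<close>

lemma quadratic_bounds_linear_substitution:
  fixes A :: "'a::real_inner \<Rightarrow> 'a"
  assumes qb: "quadratic_bounds \<mu> L f g" and "0 \<le> \<mu>" "0 \<le> L"
    and A: "linear A" "\<And>u v. A u \<bullet> v = u \<bullet> A v"
    and "\<And>v. a * (norm v)\<^sup>2 \<le> (norm (A v))\<^sup>2" "\<And>v. (norm (A v))\<^sup>2 \<le> b * (norm v)\<^sup>2"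
  shows "quadratic_bounds (a * \<mu>) (b * L) (\<lambda>y. f (A y)) (\<lambda>y. A (g (A y)))"
  unfolding quadratic_bounds_def
proof (intro conjI allI)
  fix x y
  have lin: "A (g (A x)) \<bullet> (y - x) = g (A x) \<bullet> (A y - A x)"
    by (simp add: A(2) linear_diff[OF A(1)])
  have "\<mu> / 2 * (a * (norm (y - x))\<^sup>2) \<le> \<mu> / 2 * (norm (A y - A x))\<^sup>2"
    using assms by (intro mult_left_mono) (auto simp flip: linear_diff)
  then show "f (A x) + A (g (A x)) \<bullet> (y - x) + a * \<mu> / 2 * (norm (y - x))\<^sup>2 \<le> f (A y)"
    using quadratic_bounds_lower[OF qb, of "A x" "A y"] by (simp add: lin mult_ac)
  have "L / 2 * (norm (A y - A x))\<^sup>2 \<le> L / 2 * (b * (norm (y - x))\<^sup>2)"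
    using assms by (intro mult_left_mono) (auto simp flip: linear_diff)
  then show "f (A y) \<le> f (A x) + A (g (A x)) \<bullet> (y - x) + b * L / 2 * (norm (y - x))\<^sup>2"
    using quadratic_bounds_upper[OF qb, of "A y" "A x"] by (simp add: lin mult_ac)
qed

text \<open>The Householder reflection in the hyperplane orthogonal to \<open>u - w\<close>.\<close>

lemma reflection_exists:
  fixes u w :: "'a::real_inner"
  assumes "norm u = norm w"
  shows "\<exists>R. linear R \<and> (\<forall>x y. R x \<bullet> y = x \<bullet> R y) \<and> (\<forall>x. R (R x) = x) \<and> R u = w"
proof (cases "u = w")
  case True
  then show ?thesis by (intro exI[of _ id]) (auto simp: linear_id)
next
  case False
  define n where "n = u - w"
  define R where "R = (\<lambda>x. x - (2 * (n \<bullet> x) / (n \<bullet> n)) *\<^sub>R n)"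
  have nn: "n \<bullet> n \<noteq> 0" using False by (simp add: n_def)
  have "u \<bullet> u = w \<bullet> w" using assms by (simp add: norm_eq)
  then have "2 * (n \<bullet> u) = n \<bullet> n"
    by (simp add: n_def inner_simps inner_commute)
  then have "R u = w" using nn by (simp add: R_def n_def)
  moreover have "linear R"
    by (rule linearI) (simp_all add: R_def inner_simps algebra_simps add_divide_distrib)
  moreover have "R x \<bullet> y = x \<bullet> R y" for x y
    by (simp add: R_def inner_simps inner_commute)
  moreover have "R (R x) = x" for x
    using nn by (simp add: R_def inner_simps algebra_simps)
  ultimately show ?thesis by blast
qed

text \<open>The converse of the Kantorovich bound on the angle between a vector and its image under a
  positive definite operator. If \<open>\<epsilon> w = p - u\<close> with \<open>\<parallel>w\<parallel> = \<parallel>u\<parallel>\<close> and \<open>R\<close> is a reflection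
  taking \<open>u\<close> to \<open>w\<close>, then \<open>P = I + \<epsilon> R\<close> takes \<open>u\<close> to \<open>p\<close>, and its eigenvalues are
  \<open>1 + \<epsilon>\<close> and \<open>1 - \<epsilon>\<close>, since those of \<open>R\<close> are \<open>1\<close> and \<open>- 1\<close>. As \<open>R\<^sup>2 = I\<close>, the square root
  \<open>A\<close> of \<open>P\<close> can be sought in the form \<open>a I + b R\<close>.\<close>

lemma self_adjoint_square_root_exists:
  fixes u p :: "'a::real_inner"
  assumes "0 \<le> \<epsilon>" "\<epsilon> < 1" and "norm (p - u) = \<epsilon> * norm u"
  shows "\<exists>A. linear A \<and> surj A \<and> (\<forall>x y. A x \<bullet> y = x \<bullet> A y) \<and> A (A u) = p \<and>
    (\<forall>v. (1 - \<epsilon>) * (norm v)\<^sup>2 \<le> (norm (A v))\<^sup>2 \<and> (norm (A v))\<^sup>2 \<le> (1 + \<epsilon>) * (norm v)\<^sup>2)"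
proof -
  have "\<exists>w. norm u = norm w \<and> \<epsilon> *\<^sub>R w = p - u"
  proof (cases "\<epsilon> = 0")
    case True
    then show ?thesis using assms by auto
  next
    case False
    then show ?thesis using assms by (intro exI[of _ "(1 / \<epsilon>) *\<^sub>R (p - u)"]) auto
  qed
  then obtain w where w: "norm u = norm w" "\<epsilon> *\<^sub>R w = p - u" by blast
  obtain R where R: "linear R" "\<And>x y. R x \<bullet> y = x \<bullet> R y" "\<And>x. R (R x) = x" "R u = w"
    using reflection_exists[OF w(1)] by blast
  have norm_R: "norm (R v) = norm v" for v
    by (simp add: norm_eq R)
  \<comment> \<open>The solution of \<open>a\<^sup>2 + b\<^sup>2 = 1\<close>, \<open>2 a b = \<epsilon>\<close>: on the eigenspaces of \<open>R\<close> the operator \<open>A\<close> acts as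
    \<open>a + b = sqrt (1 + \<epsilon>)\<close> and \<open>a - b = sqrt (1 - \<epsilon>)\<close>.\<close>
  define a b where "a = (sqrt (1 + \<epsilon>) + sqrt (1 - \<epsilon>)) / 2" and "b = (sqrt (1 + \<epsilon>) - sqrt (1 - \<epsilon>)) / 2"
  have s: "(sqrt (1 + \<epsilon>))\<^sup>2 = 1 + \<epsilon>" "(sqrt (1 - \<epsilon>))\<^sup>2 = 1 - \<epsilon>"
    using assms by auto
  have ab: "a\<^sup>2 + b\<^sup>2 = 1" "2 * a * b = \<epsilon>" "a\<^sup>2 - b\<^sup>2 = sqrt (1 + \<epsilon>) * sqrt (1 - \<epsilon>)"
    using s by (simp_all add: a_def b_def power2_eq_square field_simps)
  then have ab_ne: "a\<^sup>2 - b\<^sup>2 \<noteq> 0" using assms by simp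
  define A where "A = (\<lambda>v. a *\<^sub>R v + b *\<^sub>R R v)"
  have lin: "linear A"
    by (rule linearI) (simp_all add: A_def linear_add[OF R(1)] linear_scale[OF R(1)] algebra_simps)
  have "A ((1 / (a\<^sup>2 - b\<^sup>2)) *\<^sub>R (a *\<^sub>R v - b *\<^sub>R R v)) = v" for v
  proof -
    have "A (a *\<^sub>R v - b *\<^sub>R R v) = (a\<^sup>2 - b\<^sup>2) *\<^sub>R v"
      by (simp add: A_def linear_diff[OF R(1)] linear_scale[OF R(1)] R(3) algebra_simps power2_eq_square)
    then show ?thesis using ab_ne by (simp add: linear_scale[OF lin])
  qed
  then have "surj A" unfolding surj_def by metis
  moreover have self_adjoint: "A x \<bullet> y = x \<bullet> A y" for x y
    by (simp add: A_def inner_simps R(2))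
  moreover have AA: "A (A v) = v + \<epsilon> *\<^sub>R R v" for v
  proof -
    have "A (A v) = (a\<^sup>2 + b\<^sup>2) *\<^sub>R v + (2 * a * b) *\<^sub>R R v"
      by (simp add: A_def linear_add[OF R(1)] linear_scale[OF R(1)] R(3) algebra_simps power2_eq_square
          flip: scaleR_2)
    then show ?thesis by (simp only: ab scaleR_one)
  qed
  moreover have "(1 - \<epsilon>) * (norm v)\<^sup>2 \<le> (norm (A v))\<^sup>2 \<and> (norm (A v))\<^sup>2 \<le> (1 + \<epsilon>) * (norm v)\<^sup>2" for v
  proof -
    have "A v \<bullet> A v = v \<bullet> A (A v)" by (rule self_adjoint)
    then have "(norm (A v))\<^sup>2 = (norm v)\<^sup>2 + \<epsilon> * (v \<bullet> R v)"
      by (simp add: power2_norm_eq_inner AA inner_simps)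
    moreover have "\<bar>v \<bullet> R v\<bar> \<le> (norm v)\<^sup>2"
      using Cauchy_Schwarz_ineq2[of v "R v"] by (simp add: norm_R power2_eq_square)
    then have "\<bar>\<epsilon> * (v \<bullet> R v)\<bar> \<le> \<epsilon> * (norm v)\<^sup>2"
      using assms by (simp add: abs_mult mult_left_mono)
    ultimately show ?thesis by (simp add: algebra_simps abs_le_iff)
  qed
  ultimately show ?thesis using lin w R(4) by (intro exI[of _ A]) auto
qed

text \<open>The hypotheses on \<open>d\<close> say that the sine of its angle with the gradient is at most \<open>\<epsilon>\<close>. After
  the substitution \<open>x = A y\<close> the gradient becomes \<open>A (g (A y))\<close>, so orthogonality of the new
  gradients at the two ends of the step amounts to orthogonality of \<open>g x1\<close> to \<open>A (A (g x0))\<close>,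
  which is a multiple of \<open>d\<close>.\<close>

lemma inexact_direction_rate:
  fixes f :: "'a::real_inner \<Rightarrow> real"
  assumes qb: "quadratic_bounds \<mu> L f g" and \<mu>: "0 < \<mu>" "\<mu> < L"
    and \<epsilon>: "0 \<le> \<epsilon>" "\<epsilon> < 1"
    and d: "g x0 \<bullet> d = (norm (g x0))\<^sup>2" "(1 - \<epsilon>\<^sup>2) * (norm d)\<^sup>2 \<le> (norm (g x0))\<^sup>2" "g x0 \<noteq> 0"
    and x1: "x1 = x0 - t *\<^sub>R d" "g x1 \<bullet> d = 0" and xs: "g xs = 0"
  shows "((1 + \<epsilon>) * L + (1 - \<epsilon>) * \<mu>)\<^sup>2 * (f x1 - f xs)
       \<le> ((1 + \<epsilon>) * L - (1 - \<epsilon>) * \<mu>)\<^sup>2 * (f x0 - f xs)"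
proof -
  define G where "G = g x0"
  define c where "c = (norm G)\<^sup>2 / (norm d)\<^sup>2"
  \<comment> \<open>The exact sine, for which the operator is constructed; its spectral bounds are then relaxed
    from \<open>\<delta>\<close> to \<open>\<epsilon>\<close>. The vector \<open>c *\<^sub>R d\<close> is the orthogonal projection of \<open>G\<close> onto the line of \<open>d\<close>.\<close>
  define \<delta> where "\<delta> = sqrt (1 - c)"
  have "d \<noteq> 0" using d by auto
  then have dpos: "(norm d)\<^sup>2 > 0" by simp
  have "(norm G)\<^sup>2 \<le> norm G * norm d"
    using d(1) norm_cauchy_schwarz[of G d] by (simp add: G_def)
  then have "norm G \<le> norm d"
    using d(3) by (simp add: G_def power2_eq_square)
  then have c1: "c \<le> 1" using dpos by (simp add: c_def divide_le_eq_1_pos power_mono)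
  have c0: "c > 0" using dpos d(3) by (simp add: c_def G_def)
  have "1 - \<epsilon>\<^sup>2 \<le> c" using d(2) dpos by (simp add: c_def G_def field_simps)
  then have \<delta>: "0 \<le> \<delta>" "\<delta> \<le> \<epsilon>" "\<delta>\<^sup>2 = 1 - c"
    using c1 \<epsilon> by (auto simp: \<delta>_def intro: real_le_lsqrt)
  then have "\<delta> < 1" using \<epsilon> by simp
  have "(norm (c *\<^sub>R d - G))\<^sup>2 = c\<^sup>2 * (norm d)\<^sup>2 - 2 * c * (G \<bullet> d) + (norm G)\<^sup>2"
    by (simp add: power2_norm_eq_inner inner_simps inner_commute power2_eq_square[of c])
  also have "\<dots> = (1 - c) * (norm G)\<^sup>2"
  proof -
    have "c * (norm d)\<^sup>2 = (norm G)\<^sup>2" using dpos by (simp add: c_def)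
    then have "c\<^sup>2 * (norm d)\<^sup>2 = c * (norm G)\<^sup>2" by (simp add: power2_eq_square)
    then show ?thesis using d(1) by (simp add: G_def algebra_simps)
  qed
  also have "\<dots> = (\<delta> * norm G)\<^sup>2" by (simp add: \<delta> power_mult_distrib)
  finally have "norm (c *\<^sub>R d - G) = \<delta> * norm G"
    using \<delta>(1) by (simp add: power2_eq_iff_nonneg)
  then obtain A where A: "linear A" "surj A" "\<And>x y. A x \<bullet> y = x \<bullet> A y" "A (A G) = c *\<^sub>R d"
    "\<And>v. (1 - \<delta>) * (norm v)\<^sup>2 \<le> (norm (A v))\<^sup>2" "\<And>v. (norm (A v))\<^sup>2 \<le> (1 + \<delta>) * (norm v)\<^sup>2"
    using self_adjoint_square_root_exists[OF \<delta>(1) \<open>\<delta> < 1\<close>, of "c *\<^sub>R d" G] by blast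
  have lo: "(1 - \<epsilon>) * (norm v)\<^sup>2 \<le> (norm (A v))\<^sup>2" and up: "(norm (A v))\<^sup>2 \<le> (1 + \<epsilon>) * (norm v)\<^sup>2" for v
    using A(5)[of v] A(6)[of v] mult_right_mono[of "1 - \<epsilon>" "1 - \<delta>" "(norm v)\<^sup>2"]
      mult_right_mono[of "1 + \<delta>" "1 + \<epsilon>" "(norm v)\<^sup>2"] \<delta>(2)
    by (auto intro: order_trans)
  obtain y0 y1 ys where y: "x0 = A y0" "x1 = A y1" "xs = A ys"
    using A(2) by (meson surjD)
  have "quadratic_bounds ((1 - \<epsilon>) * \<mu>) ((1 + \<epsilon>) * L) (\<lambda>y. f (A y)) (\<lambda>y. A (g (A y)))"
    using \<mu> by (intro quadratic_bounds_linear_substitution[OF qb _ _ A(1,3) lo up]) auto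
  moreover have "0 < (1 - \<epsilon>) * \<mu>" using \<epsilon> \<mu> by simp
  moreover have "(1 - \<epsilon>) * \<mu> < (1 + \<epsilon>) * L"
    using \<epsilon> \<mu> by (intro mult_le_less_imp_less) auto
  moreover have "A (g (A ys)) = 0" using xs A(1) by (simp add: y linear_0)
  moreover have "A (g (A y1)) \<bullet> (y0 - y1) = 0"
  proof -
    have "A (g (A y1)) \<bullet> (y0 - y1) = g x1 \<bullet> (x0 - x1)"
      by (simp add: A(3) linear_diff[OF A(1)] y)
    also have "\<dots> = t * (g x1 \<bullet> d)" by (simp add: x1(1))
    finally show ?thesis using x1(2) by simp
  qed
  moreover have "A (g (A y1)) \<bullet> A (g (A y0)) = 0"
    using x1(2) A(3)[of "g x1" "A G"] A(4) by (simp add: G_def flip: y)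
  ultimately show ?thesis
    using orthogonal_gradient_rate[of "(1 - \<epsilon>) * \<mu>" "(1 + \<epsilon>) * L" "\<lambda>y. f (A y)"
        "\<lambda>y. A (g (A y))" ys y1 y0]
    by (simp add: y)
qed

section \<open>Growth of the Fletcher-Reeves directions\<close>

text \<open>Let \<open>w\<close> be the component of \<open>g x0\<close> orthogonal to \<open>d\<close>. Cocoercivity confines
  \<open>g x0 - g x1\<close> to a ball depending on the step size \<open>t\<close>. The component of that difference along \<open>d\<close> is
  known, because \<open>g x1\<close> has none, so \<open>g x1\<close> lies in a ball around \<open>w\<close>, whose radius is largest for
  one explicit \<open>t\<close>. The triangle inequality then yields the bound.\<close>

lemma line_search_gradient_growth:
  assumes qb: "quadratic_bounds \<mu> L f g" and \<mu>: "0 < \<mu>" "\<mu> < L"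
    and d: "g x0 \<bullet> d = (norm (g x0))\<^sup>2" "g x0 \<noteq> 0"
    and x1: "x1 = x0 - t *\<^sub>R d" "g x1 \<bullet> d = 0"
  shows "norm (g x1) * norm d
    \<le> (norm (d - g x0) + (L - \<mu>) / (2 * sqrt (L * \<mu>)) * norm (g x0)) * norm (g x0)"
proof -
  define a D where "a = norm (g x0)" and "D = norm d"
  define \<kappa> where "\<kappa> = (L - \<mu>) / (2 * sqrt (L * \<mu>))"
  define w where "w = g x0 - (a\<^sup>2 / D\<^sup>2) *\<^sub>R d"
  have "D > 0" "a > 0" using d by (auto simp: D_def a_def)
  have \<kappa>: "\<kappa> \<ge> 0" "\<kappa>\<^sup>2 = (L - \<mu>)\<^sup>2 / (4 * L * \<mu>)"
    using \<mu> by (simp_all add: \<kappa>_def power_divide power_mult_distrib)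
  have gd: "g x0 \<bullet> d = a\<^sup>2" "d \<bullet> d = D\<^sup>2" "g x0 \<bullet> g x0 = a\<^sup>2"
    using d by (simp_all add: a_def D_def power2_norm_eq_inner)
  have split: "(norm (g x0 - g x1))\<^sup>2 = a ^ 4 / D\<^sup>2 + (norm (w - g x1))\<^sup>2"
    using gd x1(2) \<open>D > 0\<close>
    by (simp add: w_def power2_norm_eq_inner inner_simps inner_commute power2_eq_square[of a] power2_eq_square[of D] power4_eq_xxxx field_simps)
  have "(norm (g x0 - g x1))\<^sup>2 + \<mu> * L * (norm (x0 - x1))\<^sup>2 \<le> (L + \<mu>) * ((g x0 - g x1) \<bullet> (x0 - x1))"
    using interpolation_inequality[OF qb \<mu>(2), of x0 x1] interpolation_inequality[OF qb \<mu>(2), of x1 x0]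
    by (simp add: norm_minus_commute inner_simps algebra_simps)
  then have "a ^ 4 / D\<^sup>2 + (norm (w - g x1))\<^sup>2 + \<mu> * L * t\<^sup>2 * D\<^sup>2 \<le> (L + \<mu>) * t * a\<^sup>2"
    unfolding split using gd x1(2) by (simp add: x1(1) inner_simps power_mult_distrib D_def mult.assoc)
  moreover have "(L + \<mu>) * t * a\<^sup>2 \<le> \<mu> * L * t\<^sup>2 * D\<^sup>2 + (L + \<mu>)\<^sup>2 * a ^ 4 / (4 * \<mu> * L * D\<^sup>2)"
  proof -
    \<comment> \<open>Maximisation over \<open>t\<close> by completing the square.\<close>
    have "0 \<le> (2 * \<mu> * L * t * D\<^sup>2 - (L + \<mu>) * a\<^sup>2)\<^sup>2 / (4 * \<mu> * L * D\<^sup>2)"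
      using \<mu> by simp
    also have "\<dots> = \<mu> * L * t\<^sup>2 * D\<^sup>2 + (L + \<mu>)\<^sup>2 * a ^ 4 / (4 * \<mu> * L * D\<^sup>2) - (L + \<mu>) * t * a\<^sup>2"
      using \<mu> \<open>D > 0\<close> by (simp add: field_simps power2_eq_square power4_eq_xxxx)
    finally show ?thesis by simp
  qed
  moreover have "(L + \<mu>)\<^sup>2 * a ^ 4 / (4 * \<mu> * L * D\<^sup>2) - a ^ 4 / D\<^sup>2 = (\<kappa> * a\<^sup>2 / D)\<^sup>2"
  proof -
    have sq: "(\<kappa> * a\<^sup>2 / D)\<^sup>2 = \<kappa>\<^sup>2 * a ^ 4 / D\<^sup>2"
      by (simp add: power_mult_distrib power_divide)
    show ?thesis
      using \<mu> \<open>D > 0\<close> unfolding sq \<kappa>(2)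
      by (simp add: field_simps power2_eq_square)
  qed
  ultimately have "(norm (w - g x1))\<^sup>2 \<le> (\<kappa> * a\<^sup>2 / D)\<^sup>2" by linarith
  then have wg: "norm (w - g x1) \<le> \<kappa> * a\<^sup>2 / D"
    using \<kappa>(1) \<open>D > 0\<close> by (simp add: abs_le_square_iff[symmetric])
  have "(norm w * D)\<^sup>2 = (a * norm (d - g x0))\<^sup>2"
    using gd \<open>D > 0\<close>
    by (simp add: power_mult_distrib w_def power2_norm_eq_inner inner_simps inner_commute)
      (simp add: field_simps power2_eq_square power4_eq_xxxx)
  then have w: "norm w * D = a * norm (d - g x0)"
    using \<open>D > 0\<close> \<open>a > 0\<close> by (simp add: power2_eq_iff_nonneg)
  have "norm (g x1) \<le> norm w + norm (w - g x1)"
    using norm_triangle_ineq4[of w "w - g x1"] by simp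
  then have "norm (g x1) * D \<le> (norm w + \<kappa> * a\<^sup>2 / D) * D"
    using wg \<open>D > 0\<close> by (intro mult_right_mono) auto
  also have "\<dots> = (norm (d - g x0) + \<kappa> * a) * a"
    using w \<open>D > 0\<close> by (simp add: power2_eq_square algebra_simps)
  finally show ?thesis by (simp add: a_def D_def \<kappa>_def)
qed

lemma FR_line_search_orthogonal:
  assumes qb: "quadratic_bounds \<mu> L f (gradient f)" and "0 < L"
    and FR: "FR_iterations f N x d \<gamma> \<beta>" and "j < N"
  shows "gradient f (x (Suc j)) \<bullet> d j = 0"
proof (rule line_minimum_orthogonal[OF qb \<open>0 < L\<close>])
  fix s
  have *: "is_arg_min (\<lambda>t. f (x j - t *\<^sub>R d j)) (\<lambda>_. True) (\<gamma> j)" "x (Suc j) = x j - \<gamma> j *\<^sub>R d j"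
    using FR \<open>j < N\<close> by (auto simp: FR_iterations_def)
  have "f (x j - \<gamma> j *\<^sub>R d j) \<le> f (x j - (\<gamma> j - s) *\<^sub>R d j)"
    using *(1) by (auto simp: is_arg_min_def not_less)
  then show "f (x (Suc j)) \<le> f (x (Suc j) + s *\<^sub>R d j)"
    by (simp add: *(2) algebra_simps)
qed

text \<open>As \<open>\<beta>\<^sub>j = \<parallel>g\<^sub>j\<^sub>+\<^sub>1\<parallel>\<^sup>2 / \<parallel>g\<^sub>j\<parallel>\<^sup>2\<close>, the norm of \<open>d\<^sub>j\<^sub>+\<^sub>1 - g\<^sub>j\<^sub>+\<^sub>1 = \<beta>\<^sub>j d\<^sub>j\<close> contains the product
  \<open>\<parallel>g\<^sub>j\<^sub>+\<^sub>1\<parallel> \<parallel>d\<^sub>j\<parallel>\<close> that \<open>line_search_gradient_growth\<close> bounds, so the ratio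
  \<open>\<parallel>d\<^sub>j - g\<^sub>j\<parallel> / \<parallel>g\<^sub>j\<parallel>\<close> increases by at most a constant.\<close>

lemma FR_direction_growth:
  assumes qb: "quadratic_bounds \<mu> L f (gradient f)" and \<mu>: "0 < \<mu>" "\<mu> < L"
    and FR: "FR_iterations f N x d \<gamma> \<beta>" and "j \<le> N"
  shows "gradient f (x j) \<bullet> d j = (norm (gradient f (x j)))\<^sup>2 \<and>
    norm (d j - gradient f (x j)) \<le> real j * ((L - \<mu>) / (2 * sqrt (L * \<mu>))) * norm (gradient f (x j))"
  using \<open>j \<le> N\<close>
proof (induction j)
  case 0
  then show ?case using FR by (simp add: FR_iterations_def power2_norm_eq_inner)
next
  case (Suc j)
  then have "j < N" by simp
  define \<kappa> where "\<kappa> = (L - \<mu>) / (2 * sqrt (L * \<mu>))"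
  define g where "g = (\<lambda>i. gradient f (x i))"
  have step: "x (Suc j) = x j - \<gamma> j *\<^sub>R d j" "g j \<noteq> 0"
    "\<beta> j = (norm (g (Suc j)))\<^sup>2 / (norm (g j))\<^sup>2" "d (Suc j) = g (Suc j) + \<beta> j *\<^sub>R d j"
    using FR \<open>j < N\<close> by (auto simp: FR_iterations_def g_def)
  have orth: "g (Suc j) \<bullet> d j = 0"
    using FR_line_search_orthogonal[OF qb _ FR \<open>j < N\<close>] \<mu> by (simp add: g_def)
  have IH: "g j \<bullet> d j = (norm (g j))\<^sup>2" "norm (d j - g j) \<le> real j * \<kappa> * norm (g j)"
    using Suc by (auto simp: g_def \<kappa>_def)
  have "norm (g (Suc j)) * norm (d j) \<le> (norm (d j - g j) + \<kappa> * norm (g j)) * norm (g j)"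
    using line_search_gradient_growth[OF qb \<mu>, of "x j" "d j" "x (Suc j)" "\<gamma> j"] IH(1) orth step(1,2)
    by (simp add: g_def \<kappa>_def)
  also have "\<dots> \<le> (real j * \<kappa> * norm (g j) + \<kappa> * norm (g j)) * norm (g j)"
    using IH(2) by (intro mult_right_mono) auto
  also have "\<dots> = real (Suc j) * \<kappa> * (norm (g j))\<^sup>2"
    by (simp add: algebra_simps power2_eq_square)
  finally have "norm (g (Suc j)) * norm (d j) / (norm (g j))\<^sup>2 \<le> real (Suc j) * \<kappa>"
    using step(2) by (simp add: divide_le_eq)
  then have "norm (g (Suc j)) * (norm (g (Suc j)) * norm (d j) / (norm (g j))\<^sup>2)
      \<le> norm (g (Suc j)) * (real (Suc j) * \<kappa>)"
    by (intro mult_left_mono) auto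
  moreover have "norm (d (Suc j) - g (Suc j))
      = norm (g (Suc j)) * (norm (g (Suc j)) * norm (d j) / (norm (g j))\<^sup>2)"
    by (simp add: step power2_eq_square)
  ultimately have "norm (d (Suc j) - g (Suc j)) \<le> real (Suc j) * \<kappa> * norm (g (Suc j))"
    by (simp only: mult_ac)
  moreover have "g (Suc j) \<bullet> d (Suc j) = (norm (g (Suc j)))\<^sup>2"
    by (simp add: step(4) inner_simps orth power2_norm_eq_inner)
  ultimately show ?case by (simp add: g_def \<kappa>_def)
qed

section \<open>The minimum value and the convergence rate\<close>

text \<open>Beyond radius \<open>2 * norm (g 0) / \<mu>\<close> the lower quadratic bound at the origin exceeds \<open>f 0\<close>, so a
  minimiser over that ball is global.\<close>

lemma quadratic_bounds_minimiser_exists: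
  fixes f :: "'a::euclidean_space \<Rightarrow> real"
  assumes qb: "quadratic_bounds \<mu> L f g" and "0 < \<mu>" and cont: "continuous_on UNIV f"
  shows "\<exists>xs. \<forall>y. f xs \<le> f y"
proof -
  define r where "r = 2 * norm (g 0) / \<mu>"
  have "r \<ge> 0" using \<open>0 < \<mu>\<close> by (simp add: r_def)
  then have "\<exists>xs\<in>cball 0 r. \<forall>y\<in>cball 0 r. f xs \<le> f y"
    using cont by (intro continuous_attains_inf) (auto intro: continuous_on_subset)
  then obtain xs where xs: "\<forall>y\<in>cball 0 r. f xs \<le> f y" by blast
  have "f xs \<le> f y" for y
  proof (cases "y \<in> cball 0 r")
    case False
    then have "2 * norm (g 0) \<le> \<mu> * norm y"
      using \<open>0 < \<mu>\<close> by (simp add: r_def field_simps)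
    then have "norm (g 0) * norm y \<le> \<mu> / 2 * norm y * norm y"
      by (intro mult_right_mono) auto
    moreover have "- (g 0 \<bullet> y) \<le> norm (g 0) * norm y"
      using norm_cauchy_schwarz[of "g 0" "- y"] by simp
    ultimately have "f 0 \<le> f y"
      using quadratic_bounds_lower[OF qb, of 0 y] by (simp add: power2_eq_square)
    moreover have "f xs \<le> f 0" using xs \<open>r \<ge> 0\<close> by simp
    ultimately show ?thesis by simp
  qed (use xs in simp)
  then show ?thesis by blast
qed

theorem theorem2p2:
  fixes f :: "real ^ 'n \<Rightarrow> real"
    and \<mu> L q \<epsilon> :: real
    and k :: nat
    and x d :: "nat \<Rightarrow> real ^ 'n"
    and \<gamma> \<beta> :: "nat \<Rightarrow> real"
  assumes "0 < \<mu>" and "\<mu> < L"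
    and "q = \<mu> / L"
    and "f \<in> smooth_strongly_convex \<mu> L"
    and "FR_iterations f (k + 1) x d \<gamma> \<beta>"
    and "\<epsilon> = sqrt ((1 - q)\<^sup>2 * (real k)\<^sup>2 / (4 * q + (1 - q)\<^sup>2 * (real k)\<^sup>2))"
  shows "f (x (k + 1)) - min_value f
       \<le> ((1 - q * ((1 - \<epsilon>) / (1 + \<epsilon>))) / (1 + q * ((1 - \<epsilon>) / (1 + \<epsilon>))))\<^sup>2
          * (f (x k) - min_value f)"
proof -
  define g where "g = gradient f"
  define \<kappa> where "\<kappa> = (L - \<mu>) / (2 * sqrt (L * \<mu>))"
  note FR = \<open>FR_iterations f (k + 1) x d \<gamma> \<beta>\<close>
  have \<mu>: "0 < \<mu>" "\<mu> < L" "0 < L" using assms by auto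
  have qb: "quadratic_bounds \<mu> L f g"
    using smooth_strongly_convex_quadratic_bounds assms(4) by (simp add: g_def)
  have "continuous_on UNIV f"
    using assms(4) by (intro continuous_at_imp_continuous_on ballI differentiable_imp_continuous_within)
      (simp add: smooth_strongly_convex_def)
  then obtain xs where xs: "\<And>y. f xs \<le> f y"
    using quadratic_bounds_minimiser_exists[OF qb \<mu>(1)] by blast
  then have min: "min_value f = f xs"
    unfolding min_value_def by (intro Least_equality) auto
  have gxs: "g xs = 0"
    using line_minimum_orthogonal[OF qb \<mu>(3), of xs "g xs"] xs by simp
  have step: "x (k + 1) = x k - \<gamma> k *\<^sub>R d k" "g (x k) \<noteq> 0"
    using FR by (auto simp: FR_iterations_def g_def)
  have orth: "g (x (k + 1)) \<bullet> d k = 0"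
    using FR_line_search_orthogonal[OF _ \<mu>(3) FR] qb by (simp add: g_def)
  have growth: "g (x k) \<bullet> d k = (norm (g (x k)))\<^sup>2"
    "norm (d k - g (x k)) \<le> real k * \<kappa> * norm (g (x k))"
    using FR_direction_growth[OF _ \<mu>(1,2) FR, of k] qb by (simp_all add: g_def \<kappa>_def)
  have q: "0 < q" using \<mu> assms(3) by simp
  have \<kappa>: "\<kappa>\<^sup>2 = (1 - q)\<^sup>2 / (4 * q)"
    using \<mu> by (simp add: \<kappa>_def assms(3) power_divide power_mult_distrib field_simps power2_eq_square)
  have "\<epsilon>\<^sup>2 = (1 - q)\<^sup>2 * (real k)\<^sup>2 / (4 * q + (1 - q)\<^sup>2 * (real k)\<^sup>2)"
    using q assms(6) by simp
  moreover have den: "4 * q + (1 - q)\<^sup>2 * (real k)\<^sup>2 > 0"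
    using q by (intro add_pos_nonneg) auto
  \<comment> \<open>With \<open>\<epsilon>\<close> the sine of an angle and \<open>k \<kappa>\<close> its tangent, this is the relation
    \<open>cos\<^sup>2 (1 + tan\<^sup>2) = 1\<close>.\<close>
  ultimately have \<epsilon>_compl: "(1 - \<epsilon>\<^sup>2) * (1 + (real k * \<kappa>)\<^sup>2) = 1"
    using q by (simp add: power_mult_distrib \<kappa> divide_simps) (simp add: algebra_simps)
  have \<epsilon>0: "0 \<le> \<epsilon>" using assms(6) q by simp
  have "1 - \<epsilon>\<^sup>2 > 0"
    using \<epsilon>_compl by (metis zero_less_mult_pos2 zero_less_one add_pos_nonneg zero_le_power2)
  then have \<epsilon>1: "\<epsilon> < 1" using \<epsilon>0 by (simp add: power_less_one_iff abs_square_less_1)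
  have "(norm (d k))\<^sup>2 = (norm (g (x k)))\<^sup>2 + (norm (d k - g (x k)))\<^sup>2"
    using growth(1) by (simp add: power2_norm_eq_inner inner_simps inner_commute)
  also have "\<dots> \<le> (norm (g (x k)))\<^sup>2 + (real k * \<kappa> * norm (g (x k)))\<^sup>2"
    using growth(2) by (simp add: power_mono)
  also have "\<dots> = (1 + (real k * \<kappa>)\<^sup>2) * (norm (g (x k)))\<^sup>2"
    by (simp add: power_mult_distrib algebra_simps)
  finally have "(1 - \<epsilon>\<^sup>2) * (norm (d k))\<^sup>2
      \<le> (1 - \<epsilon>\<^sup>2) * ((1 + (real k * \<kappa>)\<^sup>2) * (norm (g (x k)))\<^sup>2)"
    using \<open>1 - \<epsilon>\<^sup>2 > 0\<close> by (intro mult_left_mono) auto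
  also have "\<dots> = (norm (g (x k)))\<^sup>2"
    using \<epsilon>_compl by (simp only: mult.assoc[symmetric] mult_1)
  finally have "(1 - \<epsilon>\<^sup>2) * (norm (d k))\<^sup>2 \<le> (norm (g (x k)))\<^sup>2" .
  then have "((1 + \<epsilon>) * L + (1 - \<epsilon>) * \<mu>)\<^sup>2 * (f (x (k + 1)) - f xs)
       \<le> ((1 + \<epsilon>) * L - (1 - \<epsilon>) * \<mu>)\<^sup>2 * (f (x k) - f xs)"
    using inexact_direction_rate[OF qb \<mu>(1,2) \<epsilon>0 \<epsilon>1 growth(1) _ step(2,1) orth gxs] by blast
  moreover have pos: "(1 + \<epsilon>) * L + (1 - \<epsilon>) * \<mu> > 0"
    using \<mu> \<epsilon>0 \<epsilon>1 by (intro add_pos_pos) auto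
  ultimately have "f (x (k + 1)) - f xs
      \<le> (((1 + \<epsilon>) * L - (1 - \<epsilon>) * \<mu>) / ((1 + \<epsilon>) * L + (1 - \<epsilon>) * \<mu>))\<^sup>2 * (f (x k) - f xs)"
    by (simp add: power_divide field_simps)
  moreover have "((1 + \<epsilon>) * L - (1 - \<epsilon>) * \<mu>) / ((1 + \<epsilon>) * L + (1 - \<epsilon>) * \<mu>)
      = (1 - q * ((1 - \<epsilon>) / (1 + \<epsilon>))) / (1 + q * ((1 - \<epsilon>) / (1 + \<epsilon>)))"
  proof -
    have "1 + \<epsilon> > 0" using \<epsilon>0 by simp
    then have "1 - q * ((1 - \<epsilon>) / (1 + \<epsilon>)) = ((1 + \<epsilon>) * L - (1 - \<epsilon>) * \<mu>) / ((1 + \<epsilon>) * L)"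
      "1 + q * ((1 - \<epsilon>) / (1 + \<epsilon>)) = ((1 + \<epsilon>) * L + (1 - \<epsilon>) * \<mu>) / ((1 + \<epsilon>) * L)"
      using \<mu> by (simp_all add: assms(3) divide_simps)
    then show ?thesis using \<open>1 + \<epsilon> > 0\<close> \<mu> by simp
  qed
  ultimately show ?thesis by (simp only: min)
qed

end
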